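(* Let $0\le\delta<1$, $\varphi\in\mathcal{S}^*(\delta)$, $\alpha,\beta\ge0$, $\theta\in[0,\pi)$, and let $F^\theta_{\alpha\beta}=H+\overline{G}$ be a sense-preserving harmonic mapping in $\mathbb{D}$ which is the horizontal shear of $C^\theta_{\alpha\beta}[\varphi]$ with dilatation $w_{\alpha\beta}=\alpha(1+\beta)w$. If $\alpha(\beta+2(1-\delta))\le 2$ and $\alpha(1+\beta)\|w\|<1/3$, then $F^\theta_{\alpha\beta}$ is univalent in $\mathbb{D}$.
   Context: $\mathbb{D}=\{z\in\mathbb{C}:|z|<1\}$. $\mathcal{A}$ is the class of analytic functions $\varphi$ in $\mathbb{D}$ with $\varphi(0)=0$, $\varphi'(0)=1$. For $0\le\delta<1$, $\mathcal{S}^*(\delta)$ is the class of $\varphi\in\mathcal{A}$ with $\mathrm{Re}\,[z\varphi'(z)/\varphi(z)]>\delta$ for all $z\in\mathbb{D}$. Define $$C_{\alpha\beta}[\varphi](z)=\int_0^z\Big(\frac{\varphi(\zeta)}{\zeta(1-\zeta)^{\beta}}\Big)^{\alpha}\,d\zeta,\qquad C^\theta_{\alpha\beta}[\varphi](z)=e^{-i\theta}C_{\alpha\beta}[\varphi](e^{i\theta}z),\qquad z\in\mathbb{D},$$ with the analytic branches of the powers for which the integrand equals $1$ at $\zeta=0$. Let $w$ be an analytic function in $\mathbb{D}$ with $|w(z)|<1$, and $w_{\alpha\beta}(z)=\alpha(1+\beta)w(z)$. The horizontal shear of $C^\theta_{\alpha\beta}[\varphi]$ with dilatation $w_{\alpha\beta}$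 is the harmonic mapping $F^\theta_{\alpha\beta}=H+\overline{G}$, with $H,G$ analytic in $\mathbb{D}$, $H-G=C^\theta_{\alpha\beta}[\varphi]$, $G'=w_{\alpha\beta}H'$, and normalization $H(0)=G(0)=0$, $H'(0)=1$, $G'(0)=0$. It is sense-preserving if $|H'|^2-|G'|^2>0$ (equivalently $|w_{\alpha\beta}|<1$) in $\mathbb{D}$. $\|w\|=\sup_{z\in\mathbb{D}}|w(z)|$. *)

theory Defs
  imports "HOL-Complex_Analysis.Complex_Analysis"
begin

abbreviation unit_disc :: "complex set" ("\<D>") where
  "\<D> \<equiv> ball 0 1"

definition class_A :: "(complex \<Rightarrow> complex) set" where
  "class_A = {\<phi>. \<phi> holomorphic_on \<D> \<and> \<phi> 0 = 0 \<and> deriv \<phi> 0 = 1}"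

text \<open>The quotient \<open>z \<phi>'(z) / \<phi>(z)\<close> has a removable singularity at the origin with value 1, so
  the condition at \<open>z = 0\<close> reads \<open>1 > \<delta>\<close> and is omitted (in HOL the quotient would be \<open>0 / 0 = 0\<close>).
  For \<open>\<delta> \<ge> 0\<close> the condition forces \<open>\<phi> z \<noteq> 0\<close> away from the origin.\<close>

definition starlike_of_order :: "real \<Rightarrow> (complex \<Rightarrow> complex) set" where
  "starlike_of_order \<delta> =
     {\<phi> \<in> class_A. \<forall>z \<in> \<D> - {0}. Re (z * deriv \<phi> z / \<phi> z) > \<delta>}"

text \<open>For \<open>f\<close> holomorphic and zero-free on the disc with \<open>f 0 = 1\<close>, \<open>unit_log f\<close> is the
  holomorphic logarithm of \<open>f\<close> vanishing at 0 (lemmas \<open>unit_log\<close> and \<open>unit_log_unique\<close>), and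
  \<open>unit_power f a\<close> is the analytic branch of \<open>f\<^sup>a\<close> with value 1 at 0.
  The choice operator is arbitrary only outside the disc.\<close>

definition is_unit_log :: "(complex \<Rightarrow> complex) \<Rightarrow> (complex \<Rightarrow> complex) \<Rightarrow> bool" where
  "is_unit_log f L \<longleftrightarrow> L holomorphic_on \<D> \<and> L 0 = 0 \<and> (\<forall>z \<in> \<D>. exp (L z) = f z)"

definition unit_log :: "(complex \<Rightarrow> complex) \<Rightarrow> complex \<Rightarrow> complex" where
  "unit_log f = (SOME L. is_unit_log f L)"

definition unit_power :: "(complex \<Rightarrow> complex) \<Rightarrow> real \<Rightarrow> complex \<Rightarrow> complex" where
  "unit_power f a z = exp (complex_of_real a * unit_log f z)"

lemma unit_log:
  assumes "f holomorphic_on \<D>" and "\<And>z. z \<in> \<D> \<Longrightarrow> f z \<noteq> 0" and "f 0 = 1"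
  shows "is_unit_log f (unit_log f)"
proof -
  obtain g where g: "g holomorphic_on \<D>" "\<And>z. z \<in> \<D> \<Longrightarrow> f z = exp (g z)"
    using contractible_imp_holomorphic_log[OF assms(1) convex_imp_contractible[OF convex_ball] assms(2)]
    by blast
  have "exp (g 0) = 1" using g(2)[of 0] assms(3) by simp
  then have "is_unit_log f (\<lambda>z. g z - g 0)"
    using g by (auto simp: is_unit_log_def exp_diff intro!: holomorphic_intros)
  then show ?thesis unfolding unit_log_def by (rule someI[of "is_unit_log f"])
qed

lemma unit_log_unique:
  assumes "is_unit_log f L" and "is_unit_log f M" and "z \<in> \<D>"
  shows "L z = M z"
proof -
  have hol: "(\<lambda>z. L z - M z) holomorphic_on \<D>"
    using assms by (auto simp: is_unit_log_def intro!: holomorphic_intros)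
  have e: "\<exists>n::int. L x - M x = of_real (2 * pi * of_int n) * \<i>" if "x \<in> \<D>" for x
  proof -
    have "exp (L x) = exp (M x)" using assms that by (simp add: is_unit_log_def)
    then obtain n :: int where "L x = M x + of_int (2 * n) * pi * \<i>"
      unfolding exp_eq by blast
    then show ?thesis by (intro exI[of _ n]) (simp add: algebra_simps)
  qed
  have "(\<lambda>z. L z - M z) constant_on \<D>"
  proof (rule continuous_discrete_range_constant)
    show "connected \<D>" by simp
    show "continuous_on \<D> (\<lambda>z. L z - M z)"
      using hol holomorphic_on_imp_continuous_on by blast
    fix x assume x: "x \<in> \<D>"
    have "2 * pi \<le> cmod ((L y - M y) - (L x - M x))"
      if y: "y \<in> \<D>" "L y - M y \<noteq> L x - M x" for y
    proof -
      obtain m n :: int where mn: "L x - M x = of_real (2 * pi * of_int m) * \<i>"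
        "L y - M y = of_real (2 * pi * of_int n) * \<i>"
        using e[OF x] e[OF y(1)] by blast
      then have "m \<noteq> n" using y by auto
      then have "1 \<le> \<bar>real_of_int (n - m)\<bar>" by linarith
      moreover have "(L y - M y) - (L x - M x) = of_real (2 * pi * of_int (n - m)) * \<i>"
        unfolding mn by (simp add: algebra_simps)
      then have "cmod ((L y - M y) - (L x - M x)) = \<bar>2 * pi * of_int (n - m)\<bar>"
        by (metis norm_mult norm_ii norm_of_real mult.right_neutral)
      then have "cmod ((L y - M y) - (L x - M x)) = 2 * pi * \<bar>of_int (n - m)\<bar>"
        by (simp only: abs_mult abs_numeral abs_of_pos[OF pi_gt_zero])
      ultimately show ?thesis
        using mult_left_mono[of 1 "\<bar>real_of_int (n - m)\<bar>" "2 * pi"] by simp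
    qed
    then show "\<exists>d>0. \<forall>y. y \<in> \<D> \<and> L y - M y \<noteq> L x - M x \<longrightarrow>
        d \<le> cmod ((L y - M y) - (L x - M x))"
      by (intro exI[of _ "2 * pi"]) auto
  qed
  then obtain c where c: "\<And>x. x \<in> \<D> \<Longrightarrow> L x - M x = c"
    unfolding constant_on_def by blast
  have "c = L 0 - M 0" using c[of 0] by simp
  also have "\<dots> = 0" using assms by (simp add: is_unit_log_def)
  finally show ?thesis using c[OF assms(3)] by simp
qed

text \<open>The base \<open>\<phi>(\<zeta>) / (\<zeta> (1 - \<zeta>)\<^sup>\<beta>)\<close>, with its removable singularity at 0 filled in by \<open>\<phi>'(0) = 1\<close>.\<close>

definition C_base :: "real \<Rightarrow> (complex \<Rightarrow> complex) \<Rightarrow> complex \<Rightarrow> complex" where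
  "C_base \<beta> \<phi> \<zeta> =
     (if \<zeta> = 0 then 1 else \<phi> \<zeta> / (\<zeta> * unit_power (\<lambda>\<xi>. 1 - \<xi>) \<beta> \<zeta>))"

definition C_op :: "real \<Rightarrow> real \<Rightarrow> (complex \<Rightarrow> complex) \<Rightarrow> complex \<Rightarrow> complex" where
  "C_op \<alpha> \<beta> \<phi> z = contour_integral (linepath 0 z) (unit_power (C_base \<beta> \<phi>) \<alpha>)"

definition C_rot :: "real \<Rightarrow> real \<Rightarrow> real \<Rightarrow> (complex \<Rightarrow> complex) \<Rightarrow> complex \<Rightarrow> complex" where
  "C_rot \<theta> \<alpha> \<beta> \<phi> z = exp (- \<i> * of_real \<theta>) * C_op \<alpha> \<beta> \<phi> (exp (\<i> * of_real \<theta>) * z)"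

text \<open>\<open>F = H + cnj G\<close> is the horizontal shear of \<open>f\<close> with dilatation \<open>\<omega>\<close>.\<close>

definition horizontal_shear ::
  "(complex \<Rightarrow> complex) \<Rightarrow> (complex \<Rightarrow> complex) \<Rightarrow>
   (complex \<Rightarrow> complex) \<Rightarrow> (complex \<Rightarrow> complex) \<Rightarrow> (complex \<Rightarrow> complex) \<Rightarrow> bool" where
  "horizontal_shear f \<omega> H G F \<longleftrightarrow>
     H holomorphic_on \<D> \<and> G holomorphic_on \<D> \<and>
     (\<forall>z \<in> \<D>. F z = H z + cnj (G z)) \<and>
     (\<forall>z \<in> \<D>. H z - G z = f z) \<and>
     (\<forall>z \<in> \<D>. deriv G z = \<omega> z * deriv H z) \<and>
     H 0 = 0 \<and> G 0 = 0 \<and> deriv H 0 = 1 \<and> deriv G 0 = 0"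

text \<open>Positive Jacobian of \<open>H + cnj G\<close>.\<close>

definition sense_preserving :: "(complex \<Rightarrow> complex) \<Rightarrow> (complex \<Rightarrow> complex) \<Rightarrow> bool" where
  "sense_preserving H G \<longleftrightarrow> (\<forall>z \<in> \<D>. (cmod (deriv H z))\<^sup>2 - (cmod (deriv G z))\<^sup>2 > 0)"

text \<open>Only meaningful for \<open>w\<close> bounded on the disc (a real supremum).\<close>

definition disc_norm :: "(complex \<Rightarrow> complex) \<Rightarrow> real" where
  "disc_norm w = (SUP z \<in> \<D>. cmod (w z))"

end

theory Submission
  imports Defs
begin

text \<open>
  The shear is a small perturbation of a convex map. Put \<open>f = H - G = C\<^sup>\<theta>\<^sub>\<alpha>\<^sub>\<beta>[\<phi>]\<close> and
  \<open>\<omega> = w\<^sub>\<alpha>\<^sub>\<beta>\<close>.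

  \<^item> The bound on \<open>\<alpha>\<close> makes \<open>f\<close> convex: \<open>1 + z f''/f'\<close> equals
    \<open>1 + \<alpha> (\<zeta> \<phi>'(\<zeta>)/\<phi>(\<zeta>) - 1 + \<beta> \<zeta>/(1 - \<zeta>))\<close> at \<open>\<zeta> = e\<^sup>i\<^sup>\<theta> z\<close>, and since
    \<open>Re (\<zeta>/(1 - \<zeta>)) > -1/2\<close>, its real part is at least \<open>1 - \<alpha> (\<beta> + 2 (1 - \<delta>))/2 \<ge> 0\<close>,
    strictly when \<open>\<alpha> > 0\<close>; for \<open>\<alpha> = 0\<close> it is 1 (\<open>Re_C_op_convexity_pos\<close>).

  \<^item> A locally univalent \<open>f\<close> with \<open>Re (1 + z f''/f') > 0\<close> is univalent and maps every disc
    \<open>|z| < r\<close> with \<open>r < 1\<close> onto a convex set. Behind both conclusions is one inequality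
    (\<open>support_inequality\<close>): \<open>Re ((f z - f a) / (a f'(a))) < 0\<close> whenever \<open>|z| \<le> |a|\<close> and
    \<open>z \<noteq> a\<close>. Geometrically, the tangent of the curve \<open>f(|z| = r)\<close> turns monotonically and
    exactly once around, so that the curve lies on one side of each of its tangents
    (\<open>support_on_circle\<close>), and the maximum principle carries this to the disc inside.

  \<^item> From \<open>H' - G' = f'\<close> and \<open>G' = \<omega> H'\<close> one gets \<open>G' = \<omega>/(1 - \<omega>) f'\<close>. If
    \<open>|\<omega>| \<le> c < 1/3\<close>, the factor is at most \<open>c/(1 - c) < 1/2\<close>, and integrating along a
    segment in the convex image yields \<open>|G x - G y| \<le> c/(1 - c) |f x - f y|\<close>
    (\<open>lipschitz_over_convex_map\<close>). As \<open>F = f + 2 Re G\<close>, an equality \<open>F x = F y\<close> forces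
    \<open>|f x - f y| \<le> 2 |G x - G y| \<le> 2c/(1 - c) |f x - f y|\<close>, hence \<open>f x = f y\<close> and \<open>x = y\<close>
    (\<open>shear_of_convex_map_inj_on\<close>).

  In the analysis of convex maps the derivative is given as \<open>f' = exp l\<close>. For the integral
  operator such a logarithm is at hand, the quotient \<open>f''/f'\<close> becomes \<open>l'\<close>, and the tangent
  angle of the image curves becomes the single-valued function \<open>t + Im l + \<pi>/2\<close>.
\<close>

section \<open>Maps with positive curvature on circles\<close>

text \<open>
  The curve \<open>t \<mapsto> f(r e\<^sup>i\<^sup>t)\<close> has tangent angle \<open>\<psi>(t) + \<pi>/2\<close> with \<open>\<psi>(t) = t + Im l(r e\<^sup>i\<^sup>t)\<close>,
  and \<open>\<psi>' = Re (1 + z l'(z)) > 0\<close>. The component \<open>k\<close> of the curve along the outer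
  normal at \<open>s\<close> has as derivative a negative multiple of \<open>sin (\<psi>(t) - \<psi>(s))\<close>. Over one period
  \<open>\<psi> - \<psi>(s)\<close> increases from 0 to \<open>2\<pi>\<close>, so \<open>k\<close> first decreases from \<open>k(s)\<close> and then
  increases back to it.
\<close>

lemma support_on_circle:
  fixes f l :: "complex \<Rightarrow> complex" and r s t :: real
  assumes f: "\<And>z. z \<in> \<D> \<Longrightarrow> (f has_field_derivative exp (l z)) (at z)"
    and l: "l holomorphic_on \<D>"
    and pos: "\<And>z. z \<in> \<D> \<Longrightarrow> 0 < Re (1 + z * deriv l z)"
    and r: "0 < r" "r < 1" and t: "s < t" "t < s + 2 * pi"
  shows "Re ((f (rcis r t) - f (rcis r s)) / (rcis r s * exp (l (rcis r s)))) < 0"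
proof -
  define c where "c = 1 / (rcis r s * exp (l (rcis r s)))"
  define \<psi> where "\<psi> x = x + Im (l (rcis r x))" for x
  define k where "k x = Re (c * f (rcis r x))" for x
  have D: "rcis r x \<in> \<D>" for x using r by simp
  have rcis: "(rcis r has_vector_derivative \<i> * rcis r x) (at x)" for x
    unfolding rcis_def cis_conv_exp
    by (rule has_vector_derivative_real_field) (auto intro!: derivative_eq_intros)
  have "((l \<circ> rcis r) has_vector_derivative (\<i> * rcis r x) * deriv l (rcis r x)) (at x)" for x
    by (rule field_vector_diff_chain_at[OF rcis])
      (use holomorphic_derivI[OF l open_ball D] in auto)
  from bounded_linear.has_vector_derivative[OF bounded_linear_Im this]
  have psi': "(\<psi> has_real_derivative Re (1 + rcis r x * deriv l (rcis r x))) (at x)" for x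
    unfolding \<psi>_def by (auto intro!: derivative_eq_intros
      simp: has_real_derivative_iff_has_vector_derivative o_def algebra_simps)
  have mono: "\<psi> x < \<psi> y" if "x < y" for x y
    using DERIV_pos_imp_increasing[OF that, of \<psi>] psi' pos[OF D] by blast
  have polar: "rcis r x * exp (l (rcis r x)) = rcis (r * exp (Re (l (rcis r x)))) (\<psi> x)" for x
    by (simp add: \<psi>_def rcis_def exp_eq_polar cis_mult[symmetric])
  define m where "m x = exp (Re (l (rcis r x))) / exp (Re (l (rcis r s)))" for x
  have m: "0 < m x" for x by (simp add: m_def)
  have quot: "c * (rcis r x * exp (l (rcis r x))) = rcis (m x) (\<psi> x - \<psi> s)" for x
    using r unfolding c_def polar by (simp add: rcis_divide m_def)
  have "((f \<circ> rcis r) has_vector_derivative (\<i> * rcis r x) * exp (l (rcis r x))) (at x)" for x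
    by (rule field_vector_diff_chain_at[OF rcis f[OF D]])
  from bounded_linear.has_vector_derivative[OF bounded_linear_Re
      bounded_linear.has_vector_derivative[OF bounded_linear_mult_right[of c] this]]
  have "(k has_real_derivative Re (\<i> * (c * (rcis r x * exp (l (rcis r x)))))) (at x)" for x
    unfolding k_def by (simp add: has_real_derivative_iff_has_vector_derivative o_def mult_ac)
  then have k': "(k has_real_derivative - (m x * sin (\<psi> x - \<psi> s))) (at x)" for x
    unfolding quot by (simp add: rcis_def)
  \<comment> \<open>Because \<open>l\<close> is single-valued, the tangent turns around exactly once.\<close>
  have period: "\<psi> (s + 2 * pi) = \<psi> s + 2 * pi" "k (s + 2 * pi) = k s"
    by (simp_all add: \<psi>_def k_def rcis_def cis_mult[symmetric])
  have cont: "continuous_on A \<psi>" "continuous_on A k" for A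
    by (rule continuous_at_imp_continuous_on,
        blast intro: DERIV_isCont[OF psi'] DERIV_isCont[OF k'])+
  obtain u where u: "s \<le> u" "u \<le> s + 2 * pi" "\<psi> u = \<psi> s + pi"
    using IVT'[of \<psi> s "\<psi> s + pi" "s + 2 * pi"] period cont(1) by auto
  have "k t < k s"
  proof (cases "t \<le> u")
    case True
    show ?thesis
    proof (rule DERIV_neg_imp_decreasing_open[OF t(1)])
      fix x assume "s < x" "x < t"
      then have "0 < \<psi> x - \<psi> s" "\<psi> x - \<psi> s < pi"
        using mono[of s x] mono[of x u] True u by auto
      then have "0 < m x * sin (\<psi> x - \<psi> s)" using m by (simp add: sin_gt_zero)
      then show "\<exists>y. (k has_real_derivative y) (at x) \<and> y < 0" using k' by fastforce
    qed (rule cont)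
  next
    case False
    have "k t < k (s + 2 * pi)"
    proof (rule DERIV_pos_imp_increasing_open[OF t(2)])
      fix x assume x: "t < x" "x < s + 2 * pi"
      then have "pi < \<psi> x - \<psi> s" "\<psi> x - \<psi> s < 2 * pi"
        using mono[of u x] mono[of x "s + 2 * pi"] period False u by auto
      then have "m x * sin (\<psi> x - \<psi> s) < 0" using m by (simp add: sin_lt_zero mult_pos_neg)
      then show "\<exists>y. (k has_real_derivative y) (at x) \<and> 0 < y" using k' by fastforce
    qed (rule cont)
    then show ?thesis using period by simp
  qed
  then show ?thesis by (simp add: k_def c_def diff_divide_distrib)
qed


text \<open>
  By \<open>support_on_circle\<close> the function \<open>g = exp ((f - f a)/(a f'(a)))\<close> has modulus below 1 on
  the circle through \<open>a\<close>, except at \<open>a\<close> itself. The maximum modulus principle extends the bound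
  to the disc; it stays strict because \<open>g\<close> has no critical points and so is not constant.
\<close>
lemma support_inequality:
  fixes f l :: "complex \<Rightarrow> complex"
  assumes f: "\<And>z. z \<in> \<D> \<Longrightarrow> (f has_field_derivative exp (l z)) (at z)"
    and l: "l holomorphic_on \<D>"
    and pos: "\<And>z. z \<in> \<D> \<Longrightarrow> 0 < Re (1 + z * deriv l z)"
    and a: "a \<in> \<D>" and z: "cmod z \<le> cmod a" "z \<noteq> a"
  shows "Re ((f z - f a) / (a * exp (l a))) < 0"
proof -
  define r where "r = cmod a"
  define s where "s = Arg a"
  have "a \<noteq> 0" using z by auto
  then have r: "0 < r" "r < 1" using a by (auto simp: r_def)
  have a_eq: "a = rcis r s" by (simp add: r_def s_def rcis_cmod_Arg)
  define g where "g z = exp ((f z - f a) / (a * exp (l a)))" for z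
  have circle: "cmod (g y) < 1" if "cmod y = r" "y \<noteq> a" for y
  proof -
    obtain t where t: "s < t" "t \<le> s + 2 * pi" "y = rcis r t"
    proof (cases "Arg y > s")
      case True
      then show ?thesis using that[of "Arg y"] \<open>cmod y = r\<close> Arg_bounded[of y] Arg_bounded[of a]
        by (auto simp: s_def rcis_cmod_Arg)
    next
      case False
      have "rcis r (Arg y + 2 * pi) = y"
        using \<open>cmod y = r\<close> rcis_cmod_Arg[of y] by (simp add: rcis_def cis_mult[symmetric])
      then show ?thesis using that[of "Arg y + 2 * pi"] False Arg_bounded[of y] Arg_bounded[of a]
        by (auto simp: s_def)
    qed
    moreover have "t \<noteq> s + 2 * pi"
      using t \<open>y \<noteq> a\<close> by (auto simp: a_eq rcis_def cis_mult[symmetric])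
    ultimately show ?thesis
      using support_on_circle[OF f l pos r, of s t] by (simp add: g_def a_eq)
  qed
  have g': "(g has_field_derivative g y * (exp (l y) / (a * exp (l a)))) (at y)" if "y \<in> \<D>" for y
    unfolding g_def using f[OF that] \<open>a \<noteq> 0\<close> by (auto intro!: derivative_eq_intros)
  have sub: "cball 0 r \<subseteq> \<D>" using r by auto
  have hol: "g holomorphic_on \<D>"
    using g' by (meson holomorphic_on_open open_ball)
  have le: "cmod (g y) \<le> 1" if "y \<in> ball 0 r" for y
  proof (rule maximum_modulus_frontier[of g "ball 0 r"])
    show "g holomorphic_on interior (ball 0 r)" "continuous_on (closure (ball 0 r)) g"
      using hol sub r by (auto intro: holomorphic_on_subset holomorphic_on_imp_continuous_on
          continuous_on_subset)
    fix y :: complex assume "y \<in> frontier (ball 0 r)"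
    then show "cmod (g y) \<le> 1" using circle[of y] r by (cases "y = a") (auto simp: g_def)
  qed (use that in auto)
  have "cmod (g z) < 1"
  proof (cases "cmod z = r")
    case True
    then show ?thesis using circle z by simp
  next
    case False
    then have zr: "z \<in> ball 0 r" using z by (simp add: r_def)
    show ?thesis
    proof (rule ccontr)
      assume "\<not> cmod (g z) < 1"
      then have "cmod (g y) \<le> cmod (g z)" if "y \<in> ball 0 r" for y
        using le[OF that] by simp
      then have "g constant_on ball 0 r"
        using zr holomorphic_on_subset[OF hol order_trans[OF ball_subset_cball sub]]
        by (intro maximum_modulus_principle[of g "ball 0 r" "ball 0 r" z]) auto
      then obtain b where "\<And>y. y \<in> ball 0 r \<Longrightarrow> g y = b" unfolding constant_on_def by blast
      then have "(g has_field_derivative 0) (at z)"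
        by (intro has_field_derivative_transform_within_open[OF DERIV_const open_ball zr]) simp
      moreover have "z \<in> \<D>" using zr r by simp
      ultimately have "g z * (exp (l z) / (a * exp (l a))) = 0" using g' DERIV_unique by blast
      then show False using \<open>a \<noteq> 0\<close> by (simp add: g_def)
    qed
  qed
  then show ?thesis by (simp add: g_def)
qed

text \<open>
  The support inequality is strict for \<open>a\<close> the point of larger modulus among any two.
\<close>
lemma convex_map_inj_on:
  assumes "\<And>z. z \<in> \<D> \<Longrightarrow> (f has_field_derivative exp (l z)) (at z)"
    and "l holomorphic_on \<D>"
    and "\<And>z. z \<in> \<D> \<Longrightarrow> 0 < Re (1 + z * deriv l z)"
  shows "inj_on f \<D>"
proof (rule inj_onI)
  have neq: "f y \<noteq> f x" if "x \<in> \<D>" "cmod y \<le> cmod x" "y \<noteq> x" for x y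
    using support_inequality[OF assms that] by auto
  fix x y assume "x \<in> \<D>" "y \<in> \<D>" "f x = f y"
  then show "x = y" using neq[of x y] neq[of y x] by (metis linear)
qed

text \<open>
  An open set with a strict supporting line at each boundary point is convex: a segment between
  two of its points that leaves it meets the frontier, and the two endpoints would lie strictly
  on the same side of a line through that frontier point. The frontier of the image of the disc
  comes from its bounding circle, where \<open>support_inequality\<close> provides the lines.
\<close>
lemma convex_map_image_ball:
  assumes f: "\<And>z. z \<in> \<D> \<Longrightarrow> (f has_field_derivative exp (l z)) (at z)"
    and l: "l holomorphic_on \<D>"
    and pos: "\<And>z. z \<in> \<D> \<Longrightarrow> 0 < Re (1 + z * deriv l z)"
    and r: "r < 1"
  shows "convex (f ` ball 0 r)"
proof (rule ccontr)
  define \<Omega> where "\<Omega> = f ` ball 0 r"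
  have sub: "cball 0 r \<subseteq> \<D>" using r by auto
  have hol: "f holomorphic_on \<D>"
    using f by (meson holomorphic_on_open open_ball)
  have "ball 0 r \<subseteq> \<D>" using r by auto
  then have "open \<Omega>" unfolding \<Omega>_def
    using hol convex_map_inj_on[OF f l pos]
    by (intro open_mapping_thm3) (metis holomorphic_on_subset, simp, metis inj_on_subset)
  have "compact (f ` cball 0 r)"
    using hol sub by (intro compact_continuous_image)
      (auto intro: continuous_on_subset holomorphic_on_imp_continuous_on)
  then have "closure \<Omega> \<subseteq> f ` cball 0 r"
    unfolding \<Omega>_def by (intro closure_minimal image_mono) (auto simp: compact_imp_closed)
  then have frontier: "\<exists>a. cmod a = r \<and> p = f a" if "p \<in> frontier \<Omega>" for p
    using that \<open>open \<Omega>\<close> by (fastforce simp: frontier_def interior_open \<Omega>_def)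
  assume "\<not> convex (f ` ball 0 r)"
  then obtain x y where xy: "x \<in> ball 0 r" "y \<in> ball 0 r"
    and "\<not> closed_segment (f x) (f y) \<subseteq> \<Omega>"
    unfolding convex_contains_segment \<Omega>_def by blast
  then have "closed_segment (f x) (f y) \<inter> frontier \<Omega> \<noteq> {}"
    by (intro connected_Int_frontier) (auto simp: \<Omega>_def)
  then obtain a where a: "cmod a = r" "f a \<in> closed_segment (f x) (f y)"
    using frontier by blast
  then obtain u where u: "0 \<le> u" "u \<le> 1" "f a = (1 - u) *\<^sub>R f x + u *\<^sub>R f y"
    by (auto simp: closed_segment_def)
  define n where "n = 1 / (a * exp (l a))"
  have neg: "Re (n * (f z - f a)) < 0" if "z \<in> ball 0 r" for z
    using support_inequality[OF f l pos, of a z] that a r by (auto simp: n_def)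
  have "(1 - u) * Re (n * (f x - f a)) + u * Re (n * (f y - f a))
      = Re (n * ((1 - u) *\<^sub>R f x + u *\<^sub>R f y - f a))"
    by (simp add: algebra_simps scaleR_conv_of_real)
  also have "\<dots> = 0" using u by simp
  finally have "(1 - u) * Re (n * (f x - f a)) + u * Re (n * (f y - f a)) = 0" .
  moreover have "(1 - u) * Re (n * (f x - f a)) + u * Re (n * (f y - f a)) < 0"
    using convex_bound_lt[OF neg[OF xy(1)] neg[OF xy(2)], of "1 - u" u] u by simp
  ultimately show False by simp
qed

section \<open>Shears of convex maps\<close>

text \<open>
  The function \<open>G \<circ> f\<^sup>-\<^sup>1\<close> has derivative \<open>q \<circ> f\<^sup>-\<^sup>1\<close>, and the mean value inequality applies to
  it on the convex image of a disc that contains both points.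
\<close>
lemma lipschitz_over_convex_map:
  assumes f: "\<And>z. z \<in> \<D> \<Longrightarrow> (f has_field_derivative exp (l z)) (at z)"
    and l: "l holomorphic_on \<D>"
    and pos: "\<And>z. z \<in> \<D> \<Longrightarrow> 0 < Re (1 + z * deriv l z)"
    and G: "\<And>z. z \<in> \<D> \<Longrightarrow> (G has_field_derivative q z * exp (l z)) (at z)"
    and q: "\<And>z. z \<in> \<D> \<Longrightarrow> cmod (q z) \<le> K"
    and xy: "x \<in> \<D>" "y \<in> \<D>"
  shows "cmod (G x - G y) \<le> K * cmod (f x - f y)"
proof -
  obtain r where r: "max (cmod x) (cmod y) < r" "r < 1"
    using dense[of "max (cmod x) (cmod y)" 1] xy by auto
  have sub: "ball 0 r \<subseteq> \<D>" using r by auto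
  have hol: "f holomorphic_on ball 0 r" using f sub
    by (meson holomorphic_on_open open_ball holomorphic_on_subset)
  have inj: "inj_on f (ball 0 r)" using convex_map_inj_on[OF f l pos] sub by (rule inj_on_subset)
  obtain g where g: "g holomorphic_on f ` ball 0 r"
    "\<And>z. z \<in> ball 0 r \<Longrightarrow> deriv f z * deriv g (f z) = 1" "\<And>z. z \<in> ball 0 r \<Longrightarrow> g (f z) = z"
    using holomorphic_has_inverse[OF hol open_ball inj] by blast
  have "open (f ` ball 0 r)" using hol inj by (intro open_mapping_thm3) auto
  have "((\<lambda>w. G (g w)) has_field_derivative q (g w)) (at w within f ` ball 0 r)"
    and "cmod (q (g w)) \<le> K" if w: "w \<in> f ` ball 0 r" for w
  proof -
    obtain z where z: "z \<in> ball 0 r" "w = f z" using w by blast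
    then have "z \<in> \<D>" using sub by blast
    have inv: "exp (l z) * deriv g w = 1"
      using g(2)[OF z(1)] DERIV_imp_deriv[OF f[OF \<open>z \<in> \<D>\<close>]] z by simp
    have "(g has_field_derivative deriv g w) (at w)"
      using holomorphic_derivI[OF g(1) \<open>open (f ` ball 0 r)\<close> w] .
    from DERIV_chain2[of G, OF _ this]
    have "((\<lambda>w. G (g w)) has_field_derivative q z * exp (l z) * deriv g w) (at w)"
      using G[OF \<open>z \<in> \<D>\<close>] g(3)[OF z(1)] z by simp
    then show "((\<lambda>w. G (g w)) has_field_derivative q (g w)) (at w within f ` ball 0 r)"
      using inv g(3)[OF z(1)] z by (simp add: mult.assoc has_field_derivative_at_within)
    show "cmod (q (g w)) \<le> K" using q[OF \<open>z \<in> \<D>\<close>] g(3)[OF z(1)] z by simp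
  qed
  from field_differentiable_bound[OF convex_map_image_ball[OF f l pos r(2)] this, of "f x" "f y"]
  show ?thesis using g(3) r by simp
qed

text \<open>
  The constant 1/3 is where \<open>c/(1 - c)\<close>, the Lipschitz constant of \<open>G\<close> relative to \<open>f\<close>, reaches
  1/2, so that below it \<open>2 Re G\<close> varies strictly less than \<open>f\<close> between any two points.
\<close>
lemma shear_of_convex_map_inj_on:
  assumes f: "\<And>z. z \<in> \<D> \<Longrightarrow> (f has_field_derivative exp (l z)) (at z)"
    and l: "l holomorphic_on \<D>"
    and pos: "\<And>z. z \<in> \<D> \<Longrightarrow> 0 < Re (1 + z * deriv l z)"
    and shear: "horizontal_shear f \<omega> H G F"
    and \<omega>: "\<And>z. z \<in> \<D> \<Longrightarrow> cmod (\<omega> z) \<le> c" and c: "c < 1 / 3"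
  shows "inj_on F \<D>"
proof (rule inj_onI)
  have H: "H holomorphic_on \<D>" and G: "G holomorphic_on \<D>"
    and F: "\<And>z. z \<in> \<D> \<Longrightarrow> F z = H z + cnj (G z)"
    and HG: "\<And>z. z \<in> \<D> \<Longrightarrow> H z - G z = f z"
    and dil: "\<And>z. z \<in> \<D> \<Longrightarrow> deriv G z = \<omega> z * deriv H z"
    using shear by (auto simp: horizontal_shear_def)
  have "0 \<le> c" using \<omega>[of 0] norm_ge_zero[of "\<omega> 0"] by (simp del: norm_ge_zero)
  have G': "(G has_field_derivative (\<omega> z / (1 - \<omega> z)) * exp (l z)) (at z)" if z: "z \<in> \<D>" for z
  proof -
    have "((\<lambda>z. H z - G z) has_field_derivative deriv H z - deriv G z) (at z)"
      by (intro DERIV_diff holomorphic_derivI[OF H] holomorphic_derivI[OF G]) (use z in auto)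
    moreover have "((\<lambda>z. H z - G z) has_field_derivative exp (l z)) (at z)"
      by (rule has_field_derivative_transform_within_open[OF f[OF z] open_ball z]) (use HG in auto)
    ultimately have "deriv H z - deriv G z = exp (l z)" by (rule DERIV_unique)
    then have "exp (l z) = (1 - \<omega> z) * deriv H z" using dil[OF z] by (simp add: algebra_simps)
    moreover have "1 - \<omega> z \<noteq> 0" using \<omega>[OF z] c by auto
    ultimately have "deriv G z = (\<omega> z / (1 - \<omega> z)) * exp (l z)"
      using dil[OF z] by simp
    then show ?thesis using holomorphic_derivI[OF G open_ball z] by simp
  qed
  have bound: "cmod (\<omega> z / (1 - \<omega> z)) \<le> c / (1 - c)" if "z \<in> \<D>" for z
  proof -
    have "1 - c \<le> cmod (1 - \<omega> z)" using \<omega>[OF that] norm_triangle_ineq2[of 1 "\<omega> z"] by simp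
    then show ?thesis using \<omega>[OF that] c \<open>0 \<le> c\<close> unfolding norm_divide by (intro frac_le) auto
  qed
  fix x y assume xy: "x \<in> \<D>" "y \<in> \<D>" "F x = F y"
  have "F z = f z + of_real (2 * Re (G z))" if "z \<in> \<D>" for z
    using F[OF that] HG[OF that] complex_add_cnj[of "G z"] by (simp add: algebra_simps)
  then have "f x - f y = - of_real (2 * Re (G x - G y))" using xy by (simp add: algebra_simps)
  then have "cmod (f x - f y) = 2 * \<bar>Re (G x - G y)\<bar>"
    by (simp only: norm_minus_cancel norm_of_real abs_mult abs_numeral)
  also have "\<dots> \<le> 2 * cmod (G x - G y)" using abs_Re_le_cmod[of "G x - G y"] by simp
  also have "\<dots> \<le> 2 * (c / (1 - c) * cmod (f x - f y))"
    using lipschitz_over_convex_map[OF f l pos G' bound xy(1,2)] by simp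
  finally have "(1 - 2 * (c / (1 - c))) * cmod (f x - f y) \<le> 0" by (simp add: algebra_simps)
  moreover have "0 < 1 - 2 * (c / (1 - c))" using c by (simp add: field_simps)
  ultimately have "f x = f y" by (simp add: mult_le_0_iff)
  then show "x = y" using convex_map_inj_on[OF f l pos] xy by (auto dest: inj_onD)
qed

section \<open>Convexity of the integral operator\<close>

lemma has_field_derivative_unit_log:
  assumes "f holomorphic_on \<D>" and "\<And>z. z \<in> \<D> \<Longrightarrow> f z \<noteq> 0" and "f 0 = 1" and z: "z \<in> \<D>"
  shows "(unit_log f has_field_derivative deriv f z / f z) (at z)"
proof -
  note L = unit_log[OF assms(1-3), unfolded is_unit_log_def]
  have L': "(unit_log f has_field_derivative deriv (unit_log f) z) (at z)"
    using holomorphic_derivI[OF _ open_ball z] L by blast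
  have "((\<lambda>z. exp (unit_log f z)) has_field_derivative
      exp (unit_log f z) * deriv (unit_log f) z) (at z)"
    using L' by (auto intro!: derivative_eq_intros)
  then have "(f has_field_derivative exp (unit_log f z) * deriv (unit_log f) z) (at z)"
    by (rule has_field_derivative_transform_within_open[OF _ open_ball z]) (use L in auto)
  then have "deriv f z = f z * deriv (unit_log f) z" using L z DERIV_imp_deriv by fastforce
  then show ?thesis using L' assms(2)[OF z] by simp
qed

lemma has_field_derivative_unit_log_one_minus:
  assumes "z \<in> \<D>"
  shows "(unit_log (\<lambda>\<xi>. 1 - \<xi>) has_field_derivative - 1 / (1 - z)) (at z)"
proof -
  have "deriv (\<lambda>\<xi>. 1 - \<xi>) z = - 1"
    by (rule DERIV_imp_deriv) (auto intro!: derivative_eq_intros)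
  then show ?thesis
    using has_field_derivative_unit_log[of "\<lambda>\<xi>. 1 - \<xi>" z] assms
    by (force intro!: holomorphic_intros)
qed

text \<open>
  The quotient \<open>\<phi>(z)/z\<close> is holomorphic after filling in \<open>\<phi>'(0) = 1\<close>. It has no zeros: at a zero
  of \<open>\<phi>\<close> away from the origin the expression \<open>z \<phi>'(z)/\<phi>(z)\<close> would evaluate to 0 by the
  convention for division by zero, against the lower bound \<open>\<delta> \<ge> 0\<close>.
\<close>
lemma is_unit_log_C_base:
  assumes \<phi>: "\<phi> \<in> starlike_of_order \<delta>" and "0 \<le> \<delta>"
  shows "is_unit_log (C_base \<beta> \<phi>) (unit_log (C_base \<beta> \<phi>))"
proof (rule unit_log)
  define M where "M = unit_log (\<lambda>\<xi>. 1 - \<xi>)"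
  define h where "h z = (if z = 0 then deriv \<phi> 0 else (\<phi> z - \<phi> 0) / (z - 0))" for z
  have A: "\<phi> holomorphic_on \<D>" "\<phi> 0 = 0" "deriv \<phi> 0 = 1"
    and star: "\<And>z. z \<in> \<D> - {0} \<Longrightarrow> \<delta> < Re (z * deriv \<phi> z / \<phi> z)"
    using \<phi> by (auto simp: starlike_of_order_def class_A_def)
  have "is_unit_log (\<lambda>\<xi>. 1 - \<xi>) M"
    unfolding M_def by (rule unit_log) (auto intro!: holomorphic_intros)
  then have M: "M holomorphic_on \<D>" "M 0 = 0" by (auto simp: is_unit_log_def)
  have "C_base \<beta> \<phi> z = h z / exp (of_real \<beta> * M z)" for z
    using A M by (simp add: C_base_def h_def unit_power_def M_def)
  then have eq: "C_base \<beta> \<phi> = (\<lambda>z. h z / exp (of_real \<beta> * M z))" by blast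
  have "h holomorphic_on \<D>" unfolding h_def by (rule pole_lemma[OF A(1)]) auto
  then show "C_base \<beta> \<phi> holomorphic_on \<D>" unfolding eq
    using M by (auto intro!: holomorphic_intros)
  show "C_base \<beta> \<phi> 0 = 1" by (simp add: C_base_def)
  show "C_base \<beta> \<phi> z \<noteq> 0" if "z \<in> \<D>" for z
    using star[of z] that \<open>0 \<le> \<delta>\<close> A by (auto simp: eq h_def)
qed

text \<open>
  With \<open>L\<close> and \<open>M\<close> the logarithms of the base and of \<open>1 - z\<close>, the definition of the base reads
  \<open>\<phi>(z) = z exp (L(z) + \<beta> M(z))\<close> on the whole disc. The identity is the logarithmic derivative of
  this equation.
\<close>
lemma deriv_unit_log_C_base:
  assumes \<phi>: "\<phi> \<in> starlike_of_order \<delta>" and "0 \<le> \<delta>" and z: "z \<in> \<D>" "z \<noteq> 0"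
  shows "z * deriv (unit_log (C_base \<beta> \<phi>)) z = z * deriv \<phi> z / \<phi> z - 1 + of_real \<beta> * (z / (1 - z))"
proof -
  define L where "L = unit_log (C_base \<beta> \<phi>)"
  define M where "M = unit_log (\<lambda>\<xi>. 1 - \<xi>)"
  have L: "L holomorphic_on \<D>" "\<And>z. z \<in> \<D> \<Longrightarrow> exp (L z) = C_base \<beta> \<phi> z"
    using is_unit_log_C_base[OF \<phi> \<open>0 \<le> \<delta>\<close>] by (auto simp: is_unit_log_def L_def)
  have "\<phi> 0 = 0" using \<phi> by (simp add: starlike_of_order_def class_A_def)
  then have \<phi>_eq: "y * exp (L y + of_real \<beta> * M y) = \<phi> y" if "y \<in> \<D>" for y
    using that L by (cases "y = 0") (auto simp: exp_add C_base_def unit_power_def M_def)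
  have "((\<lambda>y. y * exp (L y + of_real \<beta> * M y)) has_field_derivative
      exp (L z + of_real \<beta> * M z) * (1 + z * (deriv L z + of_real \<beta> * (- 1 / (1 - z))))) (at z)"
    using has_field_derivative_unit_log_one_minus[OF z(1)] holomorphic_derivI[OF L(1) open_ball z(1)]
    by (auto intro!: derivative_eq_intros simp: M_def algebra_simps)
  then have "(\<phi> has_field_derivative
      exp (L z + of_real \<beta> * M z) * (1 + z * (deriv L z + of_real \<beta> * (- 1 / (1 - z))))) (at z)"
    by (rule has_field_derivative_transform_within_open[OF _ open_ball z(1)]) (use \<phi>_eq in auto)
  from DERIV_imp_deriv[OF this]
  have "z * deriv \<phi> z = \<phi> z * (1 + z * (deriv L z + of_real \<beta> * (- 1 / (1 - z))))"
    using \<phi>_eq[OF z(1)] by simp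
  moreover have "\<phi> z \<noteq> 0" using \<phi>_eq[OF z(1)] z(2) by auto
  ultimately have "z * deriv \<phi> z / \<phi> z = 1 + z * (deriv L z + of_real \<beta> * (- 1 / (1 - z)))"
    by simp
  then show ?thesis by (simp add: L_def algebra_simps)
qed

lemma has_field_derivative_C_op:
  assumes \<phi>: "\<phi> \<in> starlike_of_order \<delta>" and "0 \<le> \<delta>" and z: "z \<in> \<D>"
  shows "(C_op \<alpha> \<beta> \<phi> has_field_derivative exp (of_real \<alpha> * unit_log (C_base \<beta> \<phi>) z)) (at z)"
proof -
  define p where "p = unit_power (C_base \<beta> \<phi>) \<alpha>"
  have hol: "p holomorphic_on \<D>"
    using is_unit_log_C_base[OF \<phi> \<open>0 \<le> \<delta>\<close>]
    by (auto simp: is_unit_log_def p_def unit_power_def[abs_def] intro!: holomorphic_intros)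
  obtain P where "\<And>z. z \<in> \<D> \<Longrightarrow> (P has_field_derivative p z) (at z within \<D>)"
    using holomorphic_convex_primitive'[OF _ _ hol] by auto
  then have P: "\<And>z. z \<in> \<D> \<Longrightarrow> (P has_field_derivative p z) (at z)"
    by (metis at_within_open open_ball)
  have "P y - P 0 = C_op \<alpha> \<beta> \<phi> y" if "y \<in> \<D>" for y
  proof -
    have "closed_segment 0 y \<subseteq> \<D>" using that by (intro closed_segment_subset) auto
    then have "(p has_contour_integral P y - P 0) (linepath 0 y)"
      using contour_integral_primitive[of \<D> P p "linepath 0 y"] P
      by (simp add: has_field_derivative_at_within)
    then show ?thesis unfolding C_op_def p_def by (simp add: contour_integral_unique)
  qed
  moreover have "((\<lambda>y. P y - P 0) has_field_derivative p z) (at z)"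
    using P[OF z] by (auto intro!: derivative_eq_intros)
  ultimately have "(C_op \<alpha> \<beta> \<phi> has_field_derivative p z) (at z)"
    using has_field_derivative_transform_within_open[OF _ open_ball z] by blast
  then show ?thesis by (simp add: p_def unit_power_def)
qed

text \<open>The Cayley transform \<open>(1 + z)/(1 - z) = 1 + 2 z/(1 - z)\<close> has positive real part on the disc.\<close>
lemma Re_div_one_minus_gt:
  assumes "z \<in> \<D>"
  shows "- 1 / 2 < Re (z / (1 - z))"
proof -
  have "z \<noteq> 1" using assms by auto
  then have "2 * (z / (1 - z)) + 1 = (1 + z) / (1 - z)" by (simp add: field_simps)
  moreover have "0 < Re ((1 + z) / (1 - z))"
  proof -
    have "(1 + z) / (1 - z) = (1 + z) * cnj (1 - z) / of_real ((cmod (1 - z))\<^sup>2)"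
      by (rule complex_div_cnj)
    moreover have "0 < Re ((1 + z) * cnj (1 - z))"
      using assms power_strict_mono[of "cmod z" 1 2]
      by (simp add: algebra_simps cmod_power2 power2_eq_square[symmetric])
    ultimately show ?thesis using \<open>z \<noteq> 1\<close> by (simp only: Re_divide_of_real) simp
  qed
  ultimately have "0 < Re (2 * (z / (1 - z)) + 1)" by metis
  then show ?thesis by (simp del: times_divide_eq_right)
qed

text \<open>
  Since the logarithm of \<open>f'\<close> for \<open>f = C_op \<alpha> \<beta> \<phi>\<close> is \<open>\<alpha>\<close> times that of the base, this is the
  condition \<open>Re (1 + z f''/f') > 0\<close>. Strictness comes from the strict bound \<open>Re (z \<phi>'/\<phi>) > \<delta>\<close>,
  and so needs \<open>\<alpha> > 0\<close> and \<open>z \<noteq> 0\<close>; otherwise the expression is 1.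
\<close>
lemma Re_C_op_convexity_pos:
  assumes \<phi>: "\<phi> \<in> starlike_of_order \<delta>" and "0 \<le> \<delta>" and "0 \<le> \<alpha>" and "0 \<le> \<beta>"
    and le: "\<alpha> * (\<beta> + 2 * (1 - \<delta>)) \<le> 2" and z: "z \<in> \<D>"
  shows "0 < Re (1 + of_real \<alpha> * (z * deriv (unit_log (C_base \<beta> \<phi>)) z))"
proof (cases "\<alpha> = 0 \<or> z = 0")
  case False
  then have "0 < \<alpha>" "z \<noteq> 0" using \<open>0 \<le> \<alpha>\<close> by auto
  have "\<delta> < Re (z * deriv \<phi> z / \<phi> z)"
    using \<phi> z \<open>z \<noteq> 0\<close> by (simp add: starlike_of_order_def)
  moreover have "\<beta> * (- 1 / 2) \<le> \<beta> * Re (z / (1 - z))"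
    using Re_div_one_minus_gt[OF z] \<open>0 \<le> \<beta>\<close> by (intro mult_left_mono) auto
  ultimately have "\<delta> - 1 - \<beta> / 2 < Re (z * deriv (unit_log (C_base \<beta> \<phi>)) z)"
    unfolding deriv_unit_log_C_base[OF \<phi> \<open>0 \<le> \<delta>\<close> z \<open>z \<noteq> 0\<close>]
    by (simp del: times_divide_eq_right)
  then have "\<alpha> * (\<delta> - 1 - \<beta> / 2) < \<alpha> * Re (z * deriv (unit_log (C_base \<beta> \<phi>)) z)"
    using \<open>0 < \<alpha>\<close> by simp
  then show ?thesis using le by (simp add: algebra_simps)
qed auto

section \<open>Univalence of the shear\<close>

theorem theorem3p6:
  fixes \<alpha> \<beta> \<delta> \<theta> :: real and \<phi> w H G F :: "complex \<Rightarrow> complex"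
  assumes "0 \<le> \<delta>" and "\<delta> < 1"
    and "\<phi> \<in> starlike_of_order \<delta>"
    and "0 \<le> \<alpha>" and "0 \<le> \<beta>"
    and "0 \<le> \<theta>" and "\<theta> < pi"
    and "w holomorphic_on \<D>" and "\<forall>z \<in> \<D>. cmod (w z) < 1"
    and "horizontal_shear (C_rot \<theta> \<alpha> \<beta> \<phi>)
           (\<lambda>z. complex_of_real (\<alpha> * (1 + \<beta>)) * w z) H G F"
    and "sense_preserving H G"
    and "\<alpha> * (\<beta> + 2 * (1 - \<delta>)) \<le> 2"
    and "\<alpha> * (1 + \<beta>) * disc_norm w < 1 / 3"
  shows "inj_on F \<D>"
proof -
  define L where "L = unit_log (C_base \<beta> \<phi>)"
  define e where "e = exp (\<i> * of_real \<theta>)"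
  define l where "l z = of_real \<alpha> * L (e * z)" for z
  have L: "L holomorphic_on \<D>"
    using is_unit_log_C_base[OF assms(3,1)] by (simp add: is_unit_log_def L_def)
  have rot: "e * z \<in> \<D>" if "z \<in> \<D>" for z
    using that by (simp add: e_def norm_mult)
  have l': "(l has_field_derivative of_real \<alpha> * (e * deriv L (e * z))) (at z)" if "z \<in> \<D>" for z
    unfolding l_def
    by (intro DERIV_cmult, subst mult.commute, rule DERIV_chain2[of L])
      (use holomorphic_derivI[OF L open_ball rot[OF that]] in \<open>auto intro!: derivative_eq_intros\<close>)
  show ?thesis
  proof (rule shear_of_convex_map_inj_on[where l = l])
    show "(C_rot \<theta> \<alpha> \<beta> \<phi> has_field_derivative exp (l z)) (at z)" if "z \<in> \<D>" for z
    proof -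
      have d: "((\<lambda>z. C_op \<alpha> \<beta> \<phi> (e * z)) has_field_derivative exp (l z) * e) (at z)"
        unfolding l_def L_def
        by (rule DERIV_chain2[of "C_op \<alpha> \<beta> \<phi>"])
          (use has_field_derivative_C_op[OF assms(3,1) rot[OF that]] in
            \<open>auto intro!: derivative_eq_intros\<close>)
      have cancel: "exp (- \<i> * of_real \<theta>) * (exp (l z) * e) = exp (l z)"
        by (simp add: e_def exp_minus)
      show ?thesis
        using DERIV_cmult[OF d, of "exp (- \<i> * of_real \<theta>)"]
        unfolding cancel unfolding C_rot_def[abs_def] e_def .
    qed
    show "l holomorphic_on \<D>" using l' by (meson holomorphic_on_open open_ball)
    show "0 < Re (1 + z * deriv l z)" if "z \<in> \<D>" for z
      using Re_C_op_convexity_pos[OF assms(3,1,4,5,12) rot[OF that]] DERIV_imp_deriv[OF l'[OF that]]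
      by (simp add: L_def mult_ac)
    show "horizontal_shear (C_rot \<theta> \<alpha> \<beta> \<phi>) (\<lambda>z. complex_of_real (\<alpha> * (1 + \<beta>)) * w z) H G F"
      by fact
    show "cmod (complex_of_real (\<alpha> * (1 + \<beta>)) * w z) \<le> \<alpha> * (1 + \<beta>) * disc_norm w"
      if "z \<in> \<D>" for z
    proof -
      have "bdd_above ((\<lambda>z. cmod (w z)) ` \<D>)" using assms(9) by (intro bdd_aboveI[of _ 1]) auto
      then have "cmod (w z) \<le> disc_norm w" unfolding disc_norm_def
        using that by (rule cSUP_upper2) auto
      moreover have "0 \<le> \<alpha> * (1 + \<beta>)" using assms(4,5) by simp
      ultimately show ?thesis unfolding norm_mult norm_of_real
        by (simp only: abs_of_nonneg mult_left_mono)
    qed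
    show "\<alpha> * (1 + \<beta>) * disc_norm w < 1 / 3" by fact
  qed
qed

end
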